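(* Let $G$ be a graph containing no cycles of lengths $4$, $5$ and $6$, and let $xy\in E(G)$ with $N(x)\cap N(y)=\varnothing$, $d(x)\ge 2$ and $d(y)\ge 2$. Then the following are equivalent: (1) neither $x$ nor $y$ is a shedding vertex; (2) $xy$ is a relating edge.
   Context: Graphs are finite, simple, undirected. $N(v)$ denotes the neighbourhood of $v$, $N[v]=N(v)\cup\{v\}$, $d(v)=|N(v)|$, and for $S\subseteq V(G)$, $N[S]=\bigcup_{v\in S}N[v]$. A set is independent if its vertices are pairwise nonadjacent; an independent set is maximal if it is not properly contained in another independent set. A vertex $v$ is shedding if for every independent set $S\subseteq V(G)\setminus N[v]$ there exists $u\in N(v)$ such that $S\cup\{u\}$ is independent. An edge $xy$ is relating if there exists an independent set $S\subseteq V(G)\setminus N[\{x,y\}]$ such that both $S\cup\{x\}$ and $S\cup\{y\}$ are maximal independent sets of $G$. *)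

theory Defs
  imports "Graph_Theory.Graph_Theory"
begin

text \<open>
  Finite simple undirected graphs are the symmetric, loop-free pair digraphs of the library,
  i.e. those satisfying \<^locale>\<open>pair_graph\<close>: the edge \<open>uv\<close> is the pair of arcs
  \<open>(u, v)\<close> and \<open>(v, u)\<close>.
\<close>

definition nbh :: "'a pair_pre_digraph \<Rightarrow> 'a \<Rightarrow> 'a set" where
  "nbh G v = {u. (v, u) \<in> parcs G}"

definition closed_nbh :: "'a pair_pre_digraph \<Rightarrow> 'a \<Rightarrow> 'a set" where
  "closed_nbh G v = nbh G v \<union> {v}"

definition closed_nbh_set :: "'a pair_pre_digraph \<Rightarrow> 'a set \<Rightarrow> 'a set" where
  "closed_nbh_set G S = (\<Union>v\<in>S. closed_nbh G v)"

definition deg :: "'a pair_pre_digraph \<Rightarrow> 'a \<Rightarrow> nat" where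
  "deg G v = card (nbh G v)"

definition independent_set :: "'a pair_pre_digraph \<Rightarrow> 'a set \<Rightarrow> bool" where
  "independent_set G S \<longleftrightarrow> S \<subseteq> pverts G \<and> pairwise (\<lambda>u v. (u, v) \<notin> parcs G) S"

definition maximal_independent_set :: "'a pair_pre_digraph \<Rightarrow> 'a set \<Rightarrow> bool" where
  "maximal_independent_set G S \<longleftrightarrow>
     independent_set G S \<and> \<not> (\<exists>T. independent_set G T \<and> S \<subset> T)"

definition shedding :: "'a pair_pre_digraph \<Rightarrow> 'a \<Rightarrow> bool" where
  "shedding G v \<longleftrightarrow> v \<in> pverts G \<and>
     (\<forall>S. S \<subseteq> pverts G - closed_nbh G v \<and> independent_set G S \<longrightarrow>
        (\<exists>u \<in> nbh G v. independent_set G (S \<union> {u})))"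

definition relating_edge :: "'a pair_pre_digraph \<Rightarrow> 'a \<Rightarrow> 'a \<Rightarrow> bool" where
  "relating_edge G x y \<longleftrightarrow> (x, y) \<in> parcs G \<and>
     (\<exists>S. S \<subseteq> pverts G - closed_nbh_set G {x, y} \<and> independent_set G S \<and>
        maximal_independent_set G (S \<union> {x}) \<and> maximal_independent_set G (S \<union> {y}))"

text \<open>
  The library's cycles are lists of arcs, so the length of the list is the length of the cycle.
  In a symmetric digraph an edge traversed back and forth is also a cycle, of length two; from
  length three on, these cycles are those of the undirected graph.
\<close>

definition has_cycle_of_length :: "'a pair_pre_digraph \<Rightarrow> nat \<Rightarrow> bool" where
  "has_cycle_of_length G n \<longleftrightarrow> (\<exists>p. pre_digraph.cycle (with_proj G) p \<and> length p = n)"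

end

theory Submission
  imports Defs
begin

text \<open>
  A set avoiding \<open>N[x]\<close> that dominates \<open>N(x)\<close> witnesses that \<open>x\<close> is not shedding. Given such
  witnesses for \<open>x\<close> and \<open>y\<close>, keep of each only the vertices used to dominate \<open>N(x) - {y}\<close> and
  \<open>N(y) - {x}\<close>: they avoid \<open>N[{x, y}]\<close> because there is no 4-cycle, and no vertex of the one part
  is adjacent to a vertex of the other because there is no 6-cycle. A maximal independent extension
  of their union outside \<open>N[{x, y}]\<close> shows that \<open>xy\<close> is relating. Conversely, if \<open>S\<close> witnesses that
  \<open>xy\<close> is relating and \<open>w \<noteq> x\<close> is a neighbour of \<open>y\<close>, then \<open>(S - N(w)) \<union> {w}\<close> witnesses that \<open>x\<close>
  is not shedding: a neighbour of \<open>x\<close> that is dominated only by \<open>S \<inter> N(w)\<close> would give a 5-cycle.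
\<close>

text \<open>Zipping a vertex list with its own tail lists the arcs it traverses. Getting the vertex
  list back is what reduces the distinctness required of a \<open>cycle\<close> to distinctness of
  the listed vertices.\<close>

lemma (in pair_wf_digraph) awalk_zip:
  assumes "successively (\<lambda>a b. (a, b) \<in> parcs G) (v # vs @ [w])"
  shows "awalk v (zip (v # vs) (vs @ [w])) w \<and>
    pawalk_verts v (zip (v # vs) (vs @ [w])) = v # vs @ [w]"
  using assms
  by (induction vs arbitrary: v) (auto simp: awalk_simps in_arcsD2)

lemma (in pair_wf_digraph) has_cycle_of_lengthI:
  assumes "distinct (v # vs)" "successively (\<lambda>a b. (a, b) \<in> parcs G) (v # vs @ [v])"
    and "n = Suc (length vs)"
  shows "has_cycle_of_length G n"
proof -
  have "cycle (zip (v # vs) (vs @ [v]))"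
    using awalk_zip[OF assms(2)] assms(1) unfolding cycle_def
    by (intro exI[of _ v]) (cases vs; auto)
  then show ?thesis
    using assms(3) unfolding has_cycle_of_length_def by force
qed

context pair_graph
begin

lemma arc_sym: "(u, v) \<in> parcs G \<Longrightarrow> (v, u) \<in> parcs G"
  using pair_sym_arcs by (auto simp: symmetric_def dest: symD)

lemma no_loop: "(u, u) \<notin> parcs G"
  using pair_no_loops by force

lemma independent_set_iff:
  "independent_set G S \<longleftrightarrow> S \<subseteq> pverts G \<and> (\<forall>u\<in>S. \<forall>v\<in>S. (u, v) \<notin> parcs G)"
  unfolding independent_set_def pairwise_def using no_loop by metis

text \<open>Since \<open>S\<close> is independent and there are no loops, adding a neighbour
  \<open>u\<close> of \<open>v\<close> can fail only through an arc from \<open>u\<close> into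
  \<open>S\<close>.\<close>

lemma not_shedding_iff:
  assumes "v \<in> pverts G"
  shows "\<not> shedding G v \<longleftrightarrow>
    (\<exists>S. independent_set G S \<and> S \<inter> closed_nbh G v = {} \<and>
       (\<forall>u\<in>nbh G v. \<exists>s\<in>S. (u, s) \<in> parcs G))" (is "_ \<longleftrightarrow> ?R")
proof
  assume "\<not> shedding G v"
  then obtain S where S: "S \<subseteq> pverts G - closed_nbh G v" "independent_set G S"
    and dom: "\<And>u. u \<in> nbh G v \<Longrightarrow> \<not> independent_set G (S \<union> {u})"
    using assms unfolding shedding_def by blast
  have "\<exists>s\<in>S. (u, s) \<in> parcs G" if "u \<in> nbh G v" for u
    using dom[OF that] that S(2) arc_sym no_loop in_arcsD2
    unfolding independent_set_iff nbh_def by blast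
  with S show ?R by blast
next
  assume ?R
  then obtain S where S: "independent_set G S" "S \<inter> closed_nbh G v = {}"
    and dom: "\<And>u. u \<in> nbh G v \<Longrightarrow> \<exists>s\<in>S. (u, s) \<in> parcs G"
    by blast
  have "\<not> independent_set G (S \<union> {u})" if "u \<in> nbh G v" for u
    using dom[OF that] unfolding independent_set_iff by blast
  moreover have "S \<subseteq> pverts G - closed_nbh G v"
    using S unfolding independent_set_iff by blast
  ultimately show "\<not> shedding G v"
    using S(1) unfolding shedding_def by blast
qed

lemma maximal_independent_set_iff:
  "maximal_independent_set G S \<longleftrightarrow> independent_set G S \<and>
     (\<forall>v\<in>pverts G - S. \<exists>s\<in>S. (v, s) \<in> parcs G)" (is "_ \<longleftrightarrow> ?R")
proof
  assume max: "maximal_independent_set G S"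
  then have ind: "independent_set G S"
    unfolding maximal_independent_set_def by blast
  have "\<exists>s\<in>S. (v, s) \<in> parcs G" if v: "v \<in> pverts G - S" for v
  proof (rule ccontr)
    assume "\<not> (\<exists>s\<in>S. (v, s) \<in> parcs G)"
    then have "independent_set G (insert v S)"
      using ind v arc_sym no_loop unfolding independent_set_iff by blast
    with max v show False
      unfolding maximal_independent_set_def by blast
  qed
  with ind show ?R by blast
next
  assume ?R
  then show "maximal_independent_set G S"
    unfolding maximal_independent_set_def independent_set_iff by blast
qed

lemma relating_edge_sym: "relating_edge G x y \<longleftrightarrow> relating_edge G y x"
  using arc_sym unfolding relating_edge_def insert_commute[of y x] by blast

lemma relating_edge_imp_not_shedding:
  assumes no5: "\<not> has_cycle_of_length G 5"
    and disj: "nbh G x \<inter> nbh G y = {}"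
    and deg: "deg G y \<ge> 2"
    and rel: "relating_edge G x y"
  shows "\<not> shedding G x"
proof -
  have xy: "(x, y) \<in> parcs G"
    using rel unfolding relating_edge_def by blast
  obtain S where S: "S \<inter> closed_nbh_set G {x, y} = {}" "independent_set G S"
    and maxy: "maximal_independent_set G (S \<union> {y})"
    using rel unfolding relating_edge_def by blast
  have out: "s \<noteq> x" "s \<noteq> y" "(x, s) \<notin> parcs G" "(y, s) \<notin> parcs G" if "s \<in> S" for s
    using S(1) that unfolding closed_nbh_set_def closed_nbh_def nbh_def by auto
  have triangle: "\<not> ((x, v) \<in> parcs G \<and> (y, v) \<in> parcs G)" for v
    using disj unfolding nbh_def by blast
  have "\<not> nbh G y \<subseteq> {x}"
    using deg card_mono[of "{x}" "nbh G y"] unfolding deg_def by auto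
  then obtain w where w: "(y, w) \<in> parcs G" "w \<noteq> x"
    unfolding nbh_def by blast
  define T where "T = insert w {s \<in> S. (w, s) \<notin> parcs G}"
  have indT: "independent_set G T"
    using S(2) w(1) arc_sym no_loop in_arcsD2 unfolding independent_set_iff T_def by blast
  have outT: "T \<inter> closed_nbh G x = {}"
    using out w triangle unfolding T_def closed_nbh_def nbh_def by blast
  have "\<exists>t\<in>T. (v, t) \<in> parcs G" if v: "v \<in> nbh G x" for v
  \<comment> \<open>The witness \<open>S\<close> has no neighbour of \<open>y\<close>, so
    \<open>y\<close> is dominated only by the added vertex \<open>w\<close>.\<close>
  proof (cases "v = y")
    case True
    then show ?thesis using w(1) unfolding T_def by blast
  next
    case False
    have xv: "(x, v) \<in> parcs G"
      using v unfolding nbh_def by blast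
    then have "v \<in> pverts G - (S \<union> {y})"
      using False out in_arcsD2 by blast
    then obtain s where s: "s \<in> S \<union> {y}" "(v, s) \<in> parcs G"
      using maxy unfolding maximal_independent_set_iff by blast
    \<comment> \<open>If \<open>s\<close> were \<open>y\<close>, then \<open>v\<close> would be a
      common neighbour of \<open>x\<close> and \<open>y\<close>.\<close>
    have sS: "s \<in> S"
      using s xv triangle arc_sym by blast
    have "(w, s) \<notin> parcs G"
    proof
      assume ws: "(w, s) \<in> parcs G"
      have "distinct [x, v, s, w, y]"
        using False xv w xy out[OF sS] triangle no_loop s(2) ws by auto
      then have "has_cycle_of_length G 5"
        using xv s(2) arc_sym[OF ws] arc_sym[OF w(1)] arc_sym[OF xy]
        by (intro has_cycle_of_lengthI[of x "[v, s, w, y]"]) simp_all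
      with no5 show False by contradiction
    qed
    with sS s(2) show ?thesis unfolding T_def by blast
  qed
  with indT outT show ?thesis
    using not_shedding_iff[of x] in_arcsD1[OF xy] by blast
qed

text \<open>The vertex \<open>y\<close> is left out because whatever dominates it lies in
  \<open>N(y)\<close>, hence inside \<open>N[{x, y}]\<close>. The last conclusion attaches each
  vertex of \<open>A\<close> to a neighbour of \<open>x\<close> other than \<open>y\<close>; these
  paths of length two later become part of a 6-cycle.\<close>

lemma not_shedding_dominating_set:
  assumes no4: "\<not> has_cycle_of_length G 4"
    and xy: "(x, y) \<in> parcs G"
    and "\<not> shedding G x"
  obtains A where "independent_set G A" "A \<inter> closed_nbh_set G {x, y} = {}"
    "\<forall>v\<in>nbh G x - {y}. \<exists>a\<in>A. (v, a) \<in> parcs G"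
    "\<forall>a\<in>A. \<exists>v\<in>nbh G x - {y}. (v, a) \<in> parcs G"
proof -
  obtain S where S: "independent_set G S" "S \<inter> closed_nbh G x = {}"
    and dom: "\<And>u. u \<in> nbh G x \<Longrightarrow> \<exists>s\<in>S. (u, s) \<in> parcs G"
    using assms(3) not_shedding_iff[of x] in_arcsD1[OF xy] by blast
  define A where "A = {a \<in> S. \<exists>v\<in>nbh G x - {y}. (v, a) \<in> parcs G}"
  have "a \<notin> closed_nbh_set G {x, y}" if a: "a \<in> A" for a
  proof -
    obtain v where v: "(x, v) \<in> parcs G" "v \<noteq> y" "(v, a) \<in> parcs G"
      using a unfolding A_def nbh_def by blast
    have ax: "a \<noteq> x" "(x, a) \<notin> parcs G"
      using S(2) a unfolding A_def closed_nbh_def nbh_def by auto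
    have "(y, a) \<notin> parcs G"
    proof
      assume ya: "(y, a) \<in> parcs G"
      \<comment> \<open>Here \<open>a\<close> is not \<open>y\<close>, since \<open>x\<close> is
        adjacent to \<open>y\<close> but not to \<open>a\<close>.\<close>
      have "distinct [x, v, a, y]"
        using v ax ya xy no_loop by auto
      then have "has_cycle_of_length G 4"
        using v arc_sym[OF ya] arc_sym[OF xy]
        by (intro has_cycle_of_lengthI[of x "[v, a, y]"]) simp_all
      with no4 show False by contradiction
    qed
    with ax xy show ?thesis
      unfolding closed_nbh_set_def closed_nbh_def nbh_def by auto
  qed
  moreover have "independent_set G A"
    using S(1) unfolding A_def independent_set_iff by blast
  moreover have "\<forall>v\<in>nbh G x - {y}. \<exists>a\<in>A. (v, a) \<in> parcs G"
    using dom unfolding A_def by blast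
  moreover have "\<forall>a\<in>A. \<exists>v\<in>nbh G x - {y}. (v, a) \<in> parcs G"
    unfolding A_def by blast
  ultimately show thesis
    using that by blast
qed

text \<open>Take an inclusion-maximal member of the finite family of independent sets between
  \<open>I\<close> and \<open>W\<close>: an undominated vertex of \<open>W\<close> could still be
  added to it.\<close>

lemma independent_set_extend:
  assumes "independent_set G I" "I \<subseteq> W" "W \<subseteq> pverts G"
  obtains M where "independent_set G M" "I \<subseteq> M" "M \<subseteq> W"
    "\<forall>v\<in>W - M. \<exists>s\<in>M. (v, s) \<in> parcs G"
proof -
  let ?F = "{M. independent_set G M \<and> I \<subseteq> M \<and> M \<subseteq> W}"
  have "finite ?F"
    using finite_subset[OF assms(3) pair_finite_verts]
    by (intro finite_subset[of ?F "Pow W"]) auto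
  moreover have "I \<in> ?F" using assms by blast
  ultimately have "\<exists>M\<in>?F. I \<le> M \<and> (\<forall>N\<in>?F. M \<le> N \<longrightarrow> M = N)"
    by (rule finite_has_maximal2)
  then obtain M where M: "M \<in> ?F" and max: "\<forall>N\<in>?F. M \<subseteq> N \<longrightarrow> M = N"
    by (elim bexE conjE)
  have "\<exists>s\<in>M. (v, s) \<in> parcs G" if v: "v \<in> W - M" for v
  proof (rule ccontr)
    assume "\<not> (\<exists>s\<in>M. (v, s) \<in> parcs G)"
    then have "insert v M \<in> ?F"
      using M v assms(3) arc_sym no_loop unfolding independent_set_iff by blast
    then have "M = insert v M"
      using max by (simp add: subset_insertI)
    with v show False by blast
  qed
  with M that show thesis by blast
qed

lemma maximal_independent_set_insert:
  assumes xy: "(x, y) \<in> parcs G"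
    and M: "independent_set G M" "M \<inter> closed_nbh_set G {x, y} = {}"
    and max: "\<forall>v\<in>pverts G - closed_nbh_set G {x, y} - M. \<exists>s\<in>M. (v, s) \<in> parcs G"
    and dom: "\<forall>v\<in>nbh G y - {x}. \<exists>s\<in>M. (v, s) \<in> parcs G"
  shows "maximal_independent_set G (M \<union> {x})"
proof -
  have out: "(x, s) \<notin> parcs G" if "s \<in> M" for s
    using M(2) that unfolding closed_nbh_set_def closed_nbh_def nbh_def by auto
  have "independent_set G (M \<union> {x})"
    using M(1) out arc_sym no_loop in_arcsD1[OF xy] unfolding independent_set_iff by blast
  moreover have "\<exists>s\<in>M \<union> {x}. (v, s) \<in> parcs G" if v: "v \<in> pverts G - (M \<union> {x})" for v
  proof -
    \<comment> \<open>The three cases are settled by \<open>max\<close>, by \<open>x\<close> itself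
      and by \<open>dom\<close>. The vertex \<open>y\<close> falls under the second one.\<close>
    consider "v \<notin> closed_nbh_set G {x, y}" | "(x, v) \<in> parcs G" | "v \<in> nbh G y - {x}"
      using v xy unfolding closed_nbh_set_def closed_nbh_def nbh_def by blast
    then show ?thesis
      using v max dom arc_sym by cases blast+
  qed
  ultimately show ?thesis unfolding maximal_independent_set_iff by blast
qed

lemma not_shedding_imp_relating_edge:
  assumes no4: "\<not> has_cycle_of_length G 4"
    and no6: "\<not> has_cycle_of_length G 6"
    and xy: "(x, y) \<in> parcs G"
    and disj: "nbh G x \<inter> nbh G y = {}"
    and "\<not> shedding G x" "\<not> shedding G y"
  shows "relating_edge G x y"
proof -
  have comm: "closed_nbh_set G {y, x} = closed_nbh_set G {x, y}"
    by (simp add: insert_commute)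
  let ?W = "pverts G - closed_nbh_set G {x, y}"
  obtain A where A: "independent_set G A" "A \<inter> closed_nbh_set G {x, y} = {}"
    and domA: "\<forall>v\<in>nbh G x - {y}. \<exists>a\<in>A. (v, a) \<in> parcs G"
    and srcA: "\<forall>a\<in>A. \<exists>v\<in>nbh G x - {y}. (v, a) \<in> parcs G"
    using not_shedding_dominating_set[OF no4 xy assms(5)] by blast
  obtain B where B: "independent_set G B" "B \<inter> closed_nbh_set G {x, y} = {}"
    and domB: "\<forall>v\<in>nbh G y - {x}. \<exists>b\<in>B. (v, b) \<in> parcs G"
    and srcB: "\<forall>b\<in>B. \<exists>v\<in>nbh G y - {x}. (v, b) \<in> parcs G"
    using not_shedding_dominating_set[OF no4 arc_sym[OF xy] assms(6)]
    unfolding comm by blast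
  have out: "s \<noteq> x" "s \<noteq> y" "(x, s) \<notin> parcs G" "(y, s) \<notin> parcs G" if "s \<in> A \<union> B" for s
    using A(2) B(2) that unfolding closed_nbh_set_def closed_nbh_def nbh_def by auto
  have AB: "(a, b) \<notin> parcs G" if ab: "a \<in> A" "b \<in> B" for a b
  proof
    assume arc: "(a, b) \<in> parcs G"
    obtain v where v: "(x, v) \<in> parcs G" "v \<noteq> y" "(v, a) \<in> parcs G"
      using srcA ab(1) unfolding nbh_def by blast
    obtain w where w: "(y, w) \<in> parcs G" "w \<noteq> x" "(w, b) \<in> parcs G"
      using srcB ab(2) unfolding nbh_def by blast
    \<comment> \<open>Besides this, \<open>a\<close> and \<open>b\<close> are adjacent to neither
      \<open>x\<close> nor \<open>y\<close>, so neither of them can be \<open>v\<close> or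
      \<open>w\<close>.\<close>
    have "v \<noteq> w"
      using v(1) w(1) disj unfolding nbh_def by blast
    then have "distinct [x, v, a, b, w, y]"
      using v w arc xy no_loop out[of a] out[of b] ab by auto
    then have "has_cycle_of_length G 6"
      using v arc arc_sym[OF w(3)] arc_sym[OF w(1)] arc_sym[OF xy]
        by (intro has_cycle_of_lengthI[of x "[v, a, b, w, y]"]) simp_all
    with no6 show False by contradiction
  qed
  have ind: "independent_set G (A \<union> B)"
    using A(1) B(1) AB arc_sym unfolding independent_set_iff by blast
  moreover have "A \<union> B \<subseteq> ?W"
    using ind A(2) B(2) unfolding independent_set_iff by blast
  ultimately obtain M where M: "independent_set G M" "A \<union> B \<subseteq> M" "M \<subseteq> ?W"
    and max: "\<forall>v\<in>?W - M. \<exists>s\<in>M. (v, s) \<in> parcs G"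
    by (rule independent_set_extend) blast
  have MW: "M \<inter> closed_nbh_set G {x, y} = {}"
    using M(3) by blast
  \<comment> \<open>The roles cross: \<open>x\<close> already dominates its own neighbours, so
    adding \<open>x\<close> relies on \<open>B\<close> dominating the other neighbours of
    \<open>y\<close>; adding \<open>y\<close> relies on \<open>A\<close> in the same way.\<close>
  have "maximal_independent_set G (M \<union> {x})"
    using maximal_independent_set_insert[OF xy M(1) MW max] domB M(2) by blast
  moreover have "maximal_independent_set G (M \<union> {y})"
    using maximal_independent_set_insert[OF arc_sym[OF xy] M(1)] MW max domA M(2)
    unfolding comm by blast
  ultimately show ?thesis
    using xy M unfolding relating_edge_def by blast
qed

end

theorem theorem2p4:
  fixes G :: "'a pair_pre_digraph" and x y :: 'a
  assumes "pair_graph G"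
    and "\<not> has_cycle_of_length G 4"
    and "\<not> has_cycle_of_length G 5"
    and "\<not> has_cycle_of_length G 6"
    and "(x, y) \<in> parcs G"
    and "nbh G x \<inter> nbh G y = {}"
    and "deg G x \<ge> 2" and "deg G y \<ge> 2"
  shows "(\<not> shedding G x \<and> \<not> shedding G y) \<longleftrightarrow> relating_edge G x y"
proof -
  interpret pair_graph G by fact
  \<comment> \<open>This is for the use of \<open>relating_edge_imp_not_shedding\<close> with
    \<open>x\<close> and \<open>y\<close> exchanged, where the bound on \<open>deg G x\<close>
    supplies the extra neighbour.\<close>
  have "nbh G y \<inter> nbh G x = {}"
    using assms(6) by blast
  then show ?thesis
    using not_shedding_imp_relating_edge[OF assms(2,4,5,6)]
      relating_edge_imp_not_shedding[OF assms(3,6,8)]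
      relating_edge_imp_not_shedding[OF assms(3) _ assms(7), of y] relating_edge_sym
    by blast
qed

end
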